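(* Let $A$ (with values $a,\neg a$) and $C$ (with values $c,\neg c$) be binary variables joined by a link $A\rightarrow C$ quantified by fixed conditional beliefs, with beliefs combined by Dempster's rule. Then for all $x\in\{c,\neg c\}$ and $y\in\{a,\neg a\}$: (i) $bel(x)$ follows $bel(y)$ if and only if $bel(x\mid y)>bel(x\mid y\cup\neg y)$; (ii) $bel(x)$ varies inversely with $bel(y)$ if and only if $bel(x\mid y)<bel(x\mid y\cup\neg y)$; (iii) $bel(x)$ is independent of $bel(y)$ if and only if $bel(x\mid y)=bel(x\mid y\cup\neg y)$.
   Context: Convention: $\neg\neg a=a$, $\neg\neg c=c$; $a\cup\neg a$ denotes the whole frame $\{a,\neg a\}$, and $bel(a)$ abbreviates $bel(\{a\})$, etc. The conditional beliefs $bel(x\mid a)$, $bel(x\mid\neg a)$, $bel(x\mid a\cup\neg a)\in[0,1]$, $x\in\{c,\neg c\}$, are constants. The beliefs $bel(a),bel(\neg a)\ge 0$ with $bel(a)+bel(\neg a)\le 1$ vary, and the corresponding mass function on the subsets of $\{a,\neg a\}$ is $m(a)=bel(a)$, $m(\neg a)=bel(\neg a)$, $m(a\cup\neg a)=1-bel(a)-bel(\neg a)$. The beliefs at $C$ are given by Dempster's rule as $$bel(x)=m(a)\,bel(x\mid a)+m(\neg a)\,bel(x\mid\neg a)+m(a\cup\neg a)\,bel(x\mid a\cup\neg a),\qquad x\in\{c,\neg c\}.$$ Thus $bel(x)$ is a function of the two variables $bel(y)$ and $bel(\neg y)$, and its variation with $bel(y)$ is understood with $bel(\neg y)$ held fixed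 (partial derivative). Definitions: $bel(x)$ *follows* $bel(y)$ if $bel(x)$ increases when $bel(y)$ increases and decreases when $bel(y)$ decreases; it *varies inversely with* $bel(y)$ if it decreases when $bel(y)$ increases and increases when $bel(y)$ decreases; it is *independent of* $bel(y)$ if it does not change as $bel(y)$ increases and decreases. (Increase and decrease are strict, and the relations are for all admissible values; equivalently, the partial derivative $\partial bel(x)/\partial bel(y)$ is respectively positive, negative, zero.) *)

theory Defs
  imports Complex_Main
begin

datatype A_value = A | NotA
datatype C_value = C | NotC

fun neg_A :: "A_value \<Rightarrow> A_value" where
  "neg_A A = NotA"
| "neg_A NotA = A"

text \<open>
  A belief function at the parent variable is a function on subsets of its frame; the
  belief in a value \<open>y\<close> is \<open>bel {y}\<close>. On a two-element frame the admissible
  belief functions are exactly those satisfying the following conditions.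
\<close>

definition belief_fun_A :: "(A_value set \<Rightarrow> real) \<Rightarrow> bool" where
  "belief_fun_A bel \<longleftrightarrow>
     bel {} = 0 \<and> bel {A, NotA} = 1 \<and>
     bel {A} \<ge> 0 \<and> bel {NotA} \<ge> 0 \<and> bel {A} + bel {NotA} \<le> 1"

definition mass_A :: "(A_value set \<Rightarrow> real) \<Rightarrow> A_value set \<Rightarrow> real" where
  "mass_A bel S =
     (if S = {A} then bel {A}
      else if S = {NotA} then bel {NotA}
      else if S = {A, NotA} then 1 - bel {A} - bel {NotA}
      else 0)"

text \<open>
  The belief in \<open>x\<close> that Dempster's rule yields for the link, where \<open>cbel x S\<close> is the
  conditional belief in \<open>{x}\<close> given the nonempty subset \<open>S\<close> of the parent's frame.
\<close>

definition bel_C ::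
  "(C_value \<Rightarrow> A_value set \<Rightarrow> real) \<Rightarrow> C_value \<Rightarrow> (A_value set \<Rightarrow> real) \<Rightarrow> real" where
  "bel_C cbel x bel =
     mass_A bel {A} * cbel x {A} + mass_A bel {NotA} * cbel x {NotA}
     + mass_A bel {A, NotA} * cbel x {A, NotA}"

text \<open>
  Variation of a quantity \<open>F\<close> with \<open>bel {y}\<close>, the belief in the complement of \<open>y\<close> being
  held fixed: the relations compare \<open>F\<close> at any two belief functions that agree on
  \<open>{neg_A y}\<close>.
\<close>

definition follows :: "((A_value set \<Rightarrow> real) \<Rightarrow> real) \<Rightarrow> A_value \<Rightarrow> bool" where
  "follows F y \<longleftrightarrow>
     (\<forall>bel bel'. belief_fun_A bel \<and> belief_fun_A bel' \<and> bel' {neg_A y} = bel {neg_A y} \<longrightarrow>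
        (bel' {y} > bel {y} \<longrightarrow> F bel' > F bel) \<and>
        (bel' {y} < bel {y} \<longrightarrow> F bel' < F bel))"

definition varies_inversely_with :: "((A_value set \<Rightarrow> real) \<Rightarrow> real) \<Rightarrow> A_value \<Rightarrow> bool" where
  "varies_inversely_with F y \<longleftrightarrow>
     (\<forall>bel bel'. belief_fun_A bel \<and> belief_fun_A bel' \<and> bel' {neg_A y} = bel {neg_A y} \<longrightarrow>
        (bel' {y} > bel {y} \<longrightarrow> F bel' < F bel) \<and>
        (bel' {y} < bel {y} \<longrightarrow> F bel' > F bel))"

definition independent_of :: "((A_value set \<Rightarrow> real) \<Rightarrow> real) \<Rightarrow> A_value \<Rightarrow> bool" where
  "independent_of F y \<longleftrightarrow>
     (\<forall>bel bel'. belief_fun_A bel \<and> belief_fun_A bel' \<and> bel' {neg_A y} = bel {neg_A y} \<longrightarrow>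
        (bel' {y} > bel {y} \<longrightarrow> F bel' = F bel) \<and>
        (bel' {y} < bel {y} \<longrightarrow> F bel' = F bel))"

end

theory Submission
  imports Defs
begin

text \<open>With the belief in \<open>neg_A y\<close> held fixed, any mass gained by
  \<open>{y}\<close> is taken from the whole frame. Dempster's rule is linear in the masses, so the
  belief in \<open>x\<close> is affine in \<open>bel {y}\<close> with constant slope
  \<open>cbel x {y} - cbel x {y, neg_A y}\<close> (\<open>bel_C_diff\<close>). The sign of this
  slope decides which of the three relations holds; for the converses,
  \<open>ex_belief_fun_A_less\<close> supplies a pair of belief functions on which the sign
  shows.\<close>

lemma bel_C_diff:
  assumes "bel' {neg_A y} = bel {neg_A y}"
  shows "bel_C cbel x bel' - bel_C cbel x bel =
    (bel' {y} - bel {y}) * (cbel x {y} - cbel x {y, neg_A y})"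
proof -
  have "{A} \<noteq> {A, NotA}" "{NotA} \<noteq> {A, NotA}" "{A, NotA} \<noteq> {A}" "{A, NotA} \<noteq> {NotA}"
    by auto
  then show ?thesis
    using assms by (cases y) (simp_all add: bel_C_def mass_A_def insert_commute algebra_simps)
qed

text \<open>Without such a pair the three relations, being universally quantified, would hold
  vacuously.\<close>

lemma ex_belief_fun_A_less:
  "\<exists>bel bel'. belief_fun_A bel \<and> belief_fun_A bel' \<and>
    bel' {neg_A y} = bel {neg_A y} \<and> bel {y} < bel' {y}"
proof -
  \<comment> \<open>Mass \<open>t\<close> on \<open>{y}\<close>, the rest on the whole frame:
    \<open>b 0\<close> is total ignorance, \<open>b 1\<close> is certainty of
    \<open>y\<close>.\<close>
  define b where "b t S = (if S = {A, NotA} then 1 else if S = {y} then t else 0)"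
    for t :: real and S
  have "{A} \<noteq> {A, NotA}" "{NotA} \<noteq> {A, NotA}" by auto
  then have "belief_fun_A (b 0) \<and> belief_fun_A (b 1) \<and>
    b 1 {neg_A y} = b 0 {neg_A y} \<and> b 0 {y} < b 1 {y}"
    by (cases y) (simp_all add: b_def belief_fun_A_def)
  then show ?thesis by blast
qed

theorem theorem3p3:
  fixes cbel :: "C_value \<Rightarrow> A_value set \<Rightarrow> real"
  assumes "\<And>x S. S \<noteq> {} \<Longrightarrow> 0 \<le> cbel x S \<and> cbel x S \<le> 1"
  shows "\<forall>x y.
    (follows (bel_C cbel x) y \<longleftrightarrow> cbel x {y} > cbel x {y, neg_A y}) \<and>
    (varies_inversely_with (bel_C cbel x) y \<longleftrightarrow> cbel x {y} < cbel x {y, neg_A y}) \<and>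
    (independent_of (bel_C cbel x) y \<longleftrightarrow> cbel x {y} = cbel x {y, neg_A y})"
proof (intro allI)
  fix x y
  define F where "F = bel_C cbel x"
  define k where "k = cbel x {y} - cbel x {y, neg_A y}"
  have diff: "F bel' - F bel = (bel' {y} - bel {y}) * k"
    if "bel' {neg_A y} = bel {neg_A y}" for bel bel'
    using bel_C_diff[of bel' y bel cbel x] that by (simp add: F_def k_def)
  \<comment> \<open>Increases of \<open>bel {y}\<close> suffice: a decrease is an increase with
    \<open>bel\<close> and \<open>bel'\<close> exchanged.\<close>
  have up: "(F bel < F bel' \<longleftrightarrow> 0 < k) \<and> (F bel' < F bel \<longleftrightarrow> k < 0) \<and> (F bel' = F bel \<longleftrightarrow> k = 0)"
    if "bel' {neg_A y} = bel {neg_A y}" "bel {y} < bel' {y}" for bel bel'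
  proof -
    have "0 < bel' {y} - bel {y}" using that by simp
    then have "0 < F bel' - F bel \<longleftrightarrow> 0 < k" "F bel' - F bel < 0 \<longleftrightarrow> k < 0"
      unfolding diff[of bel' bel, OF that(1)] by (simp_all only: zero_less_mult_iff mult_less_0_iff) auto
    then show ?thesis by auto
  qed
  obtain b b' where b: "belief_fun_A b" "belief_fun_A b'" "b' {neg_A y} = b {neg_A y}"
    "b {y} < b' {y}"
    using ex_belief_fun_A_less by blast
  have "follows F y \<longleftrightarrow> 0 < k"
    unfolding follows_def using b up by metis
  moreover have "varies_inversely_with F y \<longleftrightarrow> k < 0"
    unfolding varies_inversely_with_def using b up by metis
  moreover have "independent_of F y \<longleftrightarrow> k = 0"
    unfolding independent_of_def using b up by metis
  ultimately show "(follows (bel_C cbel x) y \<longleftrightarrow> cbel x {y} > cbel x {y, neg_A y}) \<and>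
    (varies_inversely_with (bel_C cbel x) y \<longleftrightarrow> cbel x {y} < cbel x {y, neg_A y}) \<and>
    (independent_of (bel_C cbel x) y \<longleftrightarrow> cbel x {y} = cbel x {y, neg_A y})"
    by (simp add: F_def k_def)
qed

end
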